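(* Let $(G,w,a)$ be an infinite, locally finite, connected, oriented, weighted graph with $w(x)\equiv w_0$, where $w_0>0$ is a constant. Let $\sigma\colon E_0\to U(1)$ satisfy $\sigma(\widehat e)=\overline{\sigma(e)}$ for all $e\in E_0$, let $q\colon V\to\mathbb{R}$, and let $H=\Delta_\sigma+q$. Assume that there exists a constant $C\in\mathbb{R}$ such that $q(x)\ge -C$ for all $x\in V$. Then the operator $H|_{C_c(V)}$ is essentially self-adjoint in $\ell^2_w(V)$.
   Context: $G=(V,E)$ is a graph with vertex set $V$ and set of unoriented edges $E$, without loops and without multiple edges between vertices. Locally finite means every vertex has finite degree. $x\sim y$ means there is an edge connecting $x$ and $y$. Connected means any two vertices are joined by a finite path $x_1,\dots,x_n$ with $x_j\sim x_{j+1}$. Oriented edges: $E_0=\{[x,y],[y,x]: x,y\in V,\ x\sim y\}$; for $e=[x,y]$, $o(e)=x$ is the starting vertex, $t(e)=y$ the terminal vertex, and $\widehat e=[y,x]$ the reverse edge. An orientation is fixed by a choice of subset $E_s\subset E_0$ with $E_0=E_s\cup\widehat{E_s}$ (disjoint union), where $\widehat{E_s}=\{\widehat e: e\in E_s\}$ ("oriented graph" means that such a choice has been made). For $x\in V$, $\mathcal{O}_x=\{e\in E_0: o(e)=x\}$. Weights: $w\colon V\to\mathbb{R}^+=(0,\infty)$ and $a\colon E_0\to\mathbb{R}^+$ with $a(e)=a(\widehat e)$ for all $e\in E_0$. $U(1)=\{z\in\mathbb{C}:|z|=1\}$. $C(V)$ is the space of complex-valued functions on $V$ and $C_c(V)$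 its subspace of finitely supported functions. $\ell^2_w(V)$ is the Hilbert space of $f\in C(V)$ with $\|f\|<\infty$, with inner product $(f,g)=\sum_{x\in V}w(x)f(x)\overline{g(x)}$ and corresponding norm $\|\cdot\|$. The magnetic Laplacian $\Delta_\sigma\colon C(V)\to C(V)$ is $$(\Delta_\sigma u)(x)=\frac{1}{w(x)}\sum_{e\in\mathcal{O}_x}a(e)\bigl(u(x)-\sigma(\widehat e)u(t(e))\bigr),$$ and $Hu=\Delta_\sigma u+qu$. *)

theory Defs
  imports "HOL-Analysis.Analysis"
begin

text \<open>
  The vertex set is the whole type \<open>'v\<close>, so that \<open>C(V)\<close> is the type \<open>'v \<Rightarrow> complex\<close>.
  A graph is given by its set \<open>E\<close> of unoriented edges; an oriented edge \<open>[x,y]\<close> is the pair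
  \<open>(x, y)\<close>, with origin \<open>fst\<close>, terminus \<open>snd\<close> and reversal \<open>prod.swap\<close>.
\<close>

definition simple_graph :: "'v set set \<Rightarrow> bool" where
  "simple_graph E \<longleftrightarrow> (\<forall>e\<in>E. \<exists>x y. x \<noteq> y \<and> e = {x, y})"

definition adj :: "'v set set \<Rightarrow> 'v \<Rightarrow> 'v \<Rightarrow> bool" where
  "adj E x y \<longleftrightarrow> {x, y} \<in> E"

definition locally_finite :: "'v set set \<Rightarrow> bool" where
  "locally_finite E \<longleftrightarrow> (\<forall>x. finite {y. adj E x y})"

definition connected_graph :: "'v set set \<Rightarrow> bool" where
  "connected_graph E \<longleftrightarrow>
     (\<forall>x y. \<exists>p. p \<noteq> [] \<and> hd p = x \<and> last p = y \<and> successively (adj E) p)"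

definition oriented_edges :: "'v set set \<Rightarrow> ('v \<times> 'v) set" where
  "oriented_edges E = {(x, y). adj E x y}"

definition is_orientation :: "'v set set \<Rightarrow> ('v \<times> 'v) set \<Rightarrow> bool" where
  "is_orientation E Es \<longleftrightarrow>
     oriented_edges E = Es \<union> prod.swap ` Es \<and> Es \<inter> prod.swap ` Es = {}"

definition edges_from :: "'v set set \<Rightarrow> 'v \<Rightarrow> ('v \<times> 'v) set" where
  "edges_from E x = {e \<in> oriented_edges E. fst e = x}"

definition magnetic_laplacian ::
  "'v set set \<Rightarrow> ('v \<Rightarrow> real) \<Rightarrow> ('v \<times> 'v \<Rightarrow> real) \<Rightarrow> ('v \<times> 'v \<Rightarrow> complex)
     \<Rightarrow> ('v \<Rightarrow> complex) \<Rightarrow> ('v \<Rightarrow> complex)" where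
  "magnetic_laplacian E w a \<sigma> u = (\<lambda>x.
     1 / complex_of_real (w x) *
       (\<Sum>e\<in>edges_from E x. complex_of_real (a e) * (u x - \<sigma> (prod.swap e) * u (snd e))))"

definition magnetic_schroedinger ::
  "'v set set \<Rightarrow> ('v \<Rightarrow> real) \<Rightarrow> ('v \<times> 'v \<Rightarrow> real) \<Rightarrow> ('v \<times> 'v \<Rightarrow> complex)
     \<Rightarrow> ('v \<Rightarrow> real) \<Rightarrow> ('v \<Rightarrow> complex) \<Rightarrow> ('v \<Rightarrow> complex)" where
  "magnetic_schroedinger E w a \<sigma> q u =
     (\<lambda>x. magnetic_laplacian E w a \<sigma> u x + complex_of_real (q x) * u x)"

definition finitely_supported :: "('v \<Rightarrow> complex) set" where
  "finitely_supported = {u. finite {x. u x \<noteq> 0}}"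

definition ell2 :: "('v \<Rightarrow> real) \<Rightarrow> ('v \<Rightarrow> complex) set" where
  "ell2 w = {f. (\<lambda>x. w x * (cmod (f x))\<^sup>2) summable_on UNIV}"

definition ell2_inner :: "('v \<Rightarrow> real) \<Rightarrow> ('v \<Rightarrow> complex) \<Rightarrow> ('v \<Rightarrow> complex) \<Rightarrow> complex" where
  "ell2_inner w f g = (\<Sum>\<^sub>\<infinity>x. complex_of_real (w x) * f x * cnj (g x))"

definition ell2_norm :: "('v \<Rightarrow> real) \<Rightarrow> ('v \<Rightarrow> complex) \<Rightarrow> real" where
  "ell2_norm w f = sqrt (Re (ell2_inner w f f))"

text \<open>
  An unbounded operator in \<open>\<ell>\<^sup>2\<^sub>w(V)\<close> is represented by its graph, a set of pairs \<open>(f, T f)\<close>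
  whose domain in the sense of relations is the domain of the operator.
\<close>

type_synonym 'v operator_graph = "(('v \<Rightarrow> complex) \<times> ('v \<Rightarrow> complex)) set"

definition restricted_to ::
  "(('v \<Rightarrow> complex) \<Rightarrow> ('v \<Rightarrow> complex)) \<Rightarrow> ('v \<Rightarrow> complex) set \<Rightarrow> 'v operator_graph" where
  "restricted_to T D = {(f, T f) | f. f \<in> D}"

definition linear_operator_in :: "('v \<Rightarrow> real) \<Rightarrow> 'v operator_graph \<Rightarrow> bool" where
  "linear_operator_in w A \<longleftrightarrow>
     A \<subseteq> ell2 w \<times> ell2 w \<and> single_valued A \<and>
     (\<lambda>x. 0, \<lambda>x. 0) \<in> A \<and>
     (\<forall>(f, f')\<in>A. \<forall>(g, g')\<in>A. (\<lambda>x. f x + g x, \<lambda>x. f' x + g' x) \<in> A) \<and>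
     (\<forall>c. \<forall>(f, f')\<in>A. (\<lambda>x. c * f x, \<lambda>x. c * f' x) \<in> A)"

definition densely_defined :: "('v \<Rightarrow> real) \<Rightarrow> 'v operator_graph \<Rightarrow> bool" where
  "densely_defined w A \<longleftrightarrow>
     (\<forall>f\<in>ell2 w. \<forall>\<epsilon>>0. \<exists>g\<in>Domain A. ell2_norm w (\<lambda>x. f x - g x) < \<epsilon>)"

text \<open>
  For a densely defined operator this set is the graph of the adjoint, and the next one is
  the closure of the graph; the latter is an operator precisely when \<open>A\<close> is closable.
\<close>

definition adjoint_graph :: "('v \<Rightarrow> real) \<Rightarrow> 'v operator_graph \<Rightarrow> 'v operator_graph" where
  "adjoint_graph w A =
     {(v, z). v \<in> ell2 w \<and> z \<in> ell2 w \<and>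
        (\<forall>(u, Au)\<in>A. ell2_inner w Au v = ell2_inner w u z)}"

definition closure_graph :: "('v \<Rightarrow> real) \<Rightarrow> 'v operator_graph \<Rightarrow> 'v operator_graph" where
  "closure_graph w A =
     {(f, g). f \<in> ell2 w \<and> g \<in> ell2 w \<and>
        (\<exists>u v. (\<forall>n::nat. (u n, v n) \<in> A) \<and>
           (\<lambda>n. ell2_norm w (\<lambda>x. u n x - f x)) \<longlonglongrightarrow> 0 \<and>
           (\<lambda>n. ell2_norm w (\<lambda>x. v n x - g x)) \<longlonglongrightarrow> 0)}"

definition symmetric_operator :: "('v \<Rightarrow> real) \<Rightarrow> 'v operator_graph \<Rightarrow> bool" where
  "symmetric_operator w A \<longleftrightarrow>
     linear_operator_in w A \<and> densely_defined w A \<and>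
     (\<forall>(u, Au)\<in>A. \<forall>(v, Av)\<in>A. ell2_inner w Au v = ell2_inner w u Av)"

definition self_adjoint :: "('v \<Rightarrow> real) \<Rightarrow> 'v operator_graph \<Rightarrow> bool" where
  "self_adjoint w A \<longleftrightarrow>
     linear_operator_in w A \<and> densely_defined w A \<and> adjoint_graph w A = A"

definition essentially_self_adjoint :: "('v \<Rightarrow> real) \<Rightarrow> 'v operator_graph \<Rightarrow> bool" where
  "essentially_self_adjoint w A \<longleftrightarrow>
     symmetric_operator w A \<and> self_adjoint w (closure_graph w A)"

end

theory Submission imports Defs begin

text \<open>
  The operator \<open>H + \<lambda>\<close> with \<open>\<lambda> = C + 1\<close> satisfies \<open>\<parallel>u\<parallel> \<le> \<parallel>(H + \<lambda>) u\<parallel>\<close> on finitely supported \<open>u\<close>.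
  It is injective on \<open>\<ell>\<^sup>2\<close>: by Kato's inequality a solution of \<open>(H + \<lambda>) u = 0\<close> cannot attain a
  nonzero maximum of its modulus, whereas a square-summable function with respect to a constant
  weight attains it. Injectivity makes the range on finitely supported functions dense, and the lower
  bound then shows that every \<open>v\<close> with \<open>v, H v \<in> \<ell>\<^sup>2\<close> is a limit of finitely supported functions in
  the graph norm. Hence the closure of \<open>H\<close> is the maximal operator, which is its adjoint by
  Green's formula.
\<close>

section \<open>The Hilbert space of weighted square-summable functions\<close>

locale vertex_weight =
  fixes w :: "'v \<Rightarrow> real"
  assumes w_pos: "w x > 0"
begin

text \<open>Distributing \<open>sqrt (w x)\<close> onto \<open>f\<close> turns the weighted norm
  into an unweighted \<open>L2_set\<close>, so the finite Minkowski and Cauchy-Schwarz inequalities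
  apply. Infinite sums are then controlled by bounds uniform in \<open>F\<close>.\<close>

abbreviation partial_norm :: "('v \<Rightarrow> complex) \<Rightarrow> 'v set \<Rightarrow> real" where
  "partial_norm f F \<equiv> L2_set (\<lambda>x. sqrt (w x) * cmod (f x)) F"

lemma partial_norm_square: "(partial_norm f F)\<^sup>2 = (\<Sum>x\<in>F. w x * (cmod (f x))\<^sup>2)"
  using w_pos by (simp add: L2_set_def sum_nonneg power_mult_distrib less_imp_le)

lemma infsum_norm_square_nonneg: "(\<Sum>\<^sub>\<infinity>x. w x * (cmod (f x))\<^sup>2) \<ge> 0"
  by (rule infsum_nonneg) (use w_pos in \<open>simp add: less_imp_le\<close>)

text \<open>Covers every \<open>f\<close>: \<open>Re\<close> inverts the embedding of the reals, so
  both sums converge or neither does, and in the latter case both have the default value 0.\<close>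

lemma ell2_inner_self_infsum:
  "ell2_inner w f f = complex_of_real (\<Sum>\<^sub>\<infinity>x. w x * (cmod (f x))\<^sup>2)"
proof -
  have "complex_of_real (\<Sum>\<^sub>\<infinity>x. w x * (cmod (f x))\<^sup>2)
      = (\<Sum>\<^sub>\<infinity>x. complex_of_real (w x * (cmod (f x))\<^sup>2))"
    by (rule infsum_bounded_linear_strong[OF
        summable_on_bounded_linear_iff[OF bounded_linear_of_real bounded_linear_Re]
        bounded_linear_of_real, symmetric]) simp
  then show ?thesis
    unfolding ell2_inner_def by (simp only: of_real_mult complex_norm_square mult.assoc)
qed

lemma ell2_norm_eq: "ell2_norm w f = sqrt (\<Sum>\<^sub>\<infinity>x. w x * (cmod (f x))\<^sup>2)"
  by (simp add: ell2_norm_def ell2_inner_self_infsum)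

lemma ell2_norm_nonneg: "ell2_norm w f \<ge> 0"
  by (simp add: ell2_norm_eq infsum_norm_square_nonneg)

lemma ell2_inner_self: "ell2_inner w f f = complex_of_real ((ell2_norm w f)\<^sup>2)"
  by (simp add: ell2_inner_self_infsum ell2_norm_eq infsum_norm_square_nonneg)

lemma partial_norm_le:
  assumes "f \<in> ell2 w" "finite F"
  shows "partial_norm f F \<le> ell2_norm w f"
  unfolding ell2_norm_eq
proof (rule real_le_rsqrt)
  show "(partial_norm f F)\<^sup>2 \<le> (\<Sum>\<^sub>\<infinity>x. w x * (cmod (f x))\<^sup>2)"
    unfolding partial_norm_square using assms w_pos
    by (intro finite_sum_le_infsum) (auto simp: ell2_def less_imp_le)
qed

text \<open>Nonnegative terms with uniformly bounded finite sums are summable, and the total obeys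
  the same bound.\<close>

lemma
  assumes bound: "\<And>F. finite F \<Longrightarrow> partial_norm f F \<le> B"
  shows ell2_boundedI: "f \<in> ell2 w" and ell2_norm_le: "ell2_norm w f \<le> B"
proof -
  \<comment> \<open>The empty set supplies the sign of \<open>B\<close>, without which a bound by
    \<open>B\<^sup>2\<close> could not be turned back into a bound by \<open>B\<close>.\<close>
  have B: "B \<ge> 0"
    using bound[of "{}"] by simp
  have sum: "(\<Sum>x\<in>F. w x * (cmod (f x))\<^sup>2) \<le> B\<^sup>2" if "finite F" for F
    using power_mono[OF bound[OF that], of 2] by (simp add: partial_norm_square)
  have *: "(\<lambda>x. w x * (cmod (f x))\<^sup>2) summable_on UNIV"
    using w_pos sum
    by (intro nonneg_bdd_above_summable_on bdd_aboveI[where M = "B\<^sup>2"])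
       (auto simp: less_imp_le)
  then show "f \<in> ell2 w"
    by (simp add: ell2_def)
  show "ell2_norm w f \<le> B"
    unfolding ell2_norm_eq using infsum_le_finite_sums[OF *, of "B\<^sup>2"] sum B
    by (auto intro!: real_le_lsqrt infsum_norm_square_nonneg)
qed

text \<open>A single vertex is a finite set. Since \<open>w x > 0\<close>, this makes evaluation at
  \<open>x\<close> continuous, so norm convergence implies pointwise convergence.\<close>

lemma cmod_le_ell2_norm:
  assumes "f \<in> ell2 w"
  shows "sqrt (w x) * cmod (f x) \<le> ell2_norm w f"
  using member_le_L2_set[of "{x}" x "\<lambda>x. sqrt (w x) * cmod (f x)"]
    partial_norm_le[OF assms, of "{x}"] by simp

section \<open>Vector space structure, inner product and norm identities\<close>

lemma partial_norm_add: "partial_norm (\<lambda>x. f x + g x) F \<le> partial_norm f F + partial_norm g F"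
proof -
  have "partial_norm (\<lambda>x. f x + g x) F
      \<le> L2_set (\<lambda>x. sqrt (w x) * cmod (f x) + sqrt (w x) * cmod (g x)) F"
  proof (rule L2_set_mono)
    fix x
    show "sqrt (w x) * cmod (f x + g x) \<le> sqrt (w x) * cmod (f x) + sqrt (w x) * cmod (g x)"
      unfolding distrib_left[symmetric] using w_pos[of x]
      by (intro mult_left_mono norm_triangle_ineq) simp
  qed (use w_pos in \<open>simp add: less_imp_le\<close>)
  then show ?thesis
    by (rule order_trans[OF _ L2_set_triangle_ineq])
qed

lemma
  assumes "f \<in> ell2 w" "g \<in> ell2 w"
  shows ell2_add: "(\<lambda>x. f x + g x) \<in> ell2 w"
    and ell2_norm_add: "ell2_norm w (\<lambda>x. f x + g x) \<le> ell2_norm w f + ell2_norm w g"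
proof -
  have bound: "partial_norm (\<lambda>x. f x + g x) F \<le> ell2_norm w f + ell2_norm w g"
    if "finite F" for F
    using partial_norm_add[of f g F] partial_norm_le[OF assms(1) that]
      partial_norm_le[OF assms(2) that] by linarith
  show "(\<lambda>x. f x + g x) \<in> ell2 w"
    by (rule ell2_boundedI[OF bound])
  show "ell2_norm w (\<lambda>x. f x + g x) \<le> ell2_norm w f + ell2_norm w g"
    by (rule ell2_norm_le[OF bound])
qed

lemma ell2_scale: "f \<in> ell2 w \<Longrightarrow> (\<lambda>x. c * f x) \<in> ell2 w"
  using summable_on_cmult_right[of "\<lambda>x. w x * (cmod (f x))\<^sup>2" UNIV "(cmod c)\<^sup>2"]
  by (simp add: ell2_def norm_mult power_mult_distrib mult.left_commute)

text \<open>For \<open>f\<close> outside \<open>ell2 w\<close> both sides are 0, the default value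
  of a divergent sum.\<close>

lemma ell2_norm_scale: "ell2_norm w (\<lambda>x. c * f x) = cmod c * ell2_norm w f"
proof -
  have "(\<Sum>\<^sub>\<infinity>x. w x * (cmod (c * f x))\<^sup>2) = (\<Sum>\<^sub>\<infinity>x. (cmod c)\<^sup>2 * (w x * (cmod (f x))\<^sup>2))"
    by (simp add: norm_mult power_mult_distrib mult.left_commute)
  then show ?thesis
    unfolding ell2_norm_eq infsum_cmult_right' by (simp add: real_sqrt_mult)
qed

lemma ell2_diff: "f \<in> ell2 w \<Longrightarrow> g \<in> ell2 w \<Longrightarrow> (\<lambda>x. f x - g x) \<in> ell2 w"
  using ell2_add[of f "\<lambda>x. (-1) * g x"] ell2_scale[of g "-1"] by simp

lemma ell2_norm_minus_commute: "ell2_norm w (\<lambda>x. f x - g x) = ell2_norm w (\<lambda>x. g x - f x)"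
  unfolding ell2_norm_eq by (simp add: norm_minus_commute)

lemma ell2_norm_diff_triangle:
  assumes "f \<in> ell2 w" "g \<in> ell2 w" "h \<in> ell2 w"
  shows "ell2_norm w (\<lambda>x. f x - h x)
    \<le> ell2_norm w (\<lambda>x. f x - g x) + ell2_norm w (\<lambda>x. g x - h x)"
  using ell2_norm_add[of "\<lambda>x. f x - g x" "\<lambda>x. g x - h x"] assms by (simp add: ell2_diff)

lemma ell2_finitely_supported: "finitely_supported \<subseteq> ell2 w"
proof
  fix f :: "'v \<Rightarrow> complex"
  assume "f \<in> finitely_supported"
  then have "(\<lambda>x. w x * (cmod (f x))\<^sup>2) summable_on {x. f x \<noteq> 0}"
    by (simp add: finitely_supported_def)
  then have "(\<lambda>x. w x * (cmod (f x))\<^sup>2) summable_on UNIV"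
    by (rule summable_on_cong_neutral[THEN iffD1, rotated 3]) auto
  then show "f \<in> ell2 w"
    by (simp add: ell2_def)
qed

lemma ell2_zero: "(\<lambda>x. 0) \<in> ell2 w"
  by (simp add: ell2_def)

text \<open>Splitting \<open>w x\<close> into two square roots, one for each factor, reduces the
  finite sums of moduli to the finite Cauchy-Schwarz inequality. The uniform bound yields absolute
  summability and the estimate at once.\<close>

lemma
  assumes "f \<in> ell2 w" "g \<in> ell2 w"
  shows ell2_inner_summable: "(\<lambda>x. complex_of_real (w x) * f x * cnj (g x)) summable_on UNIV"
    and ell2_Cauchy_Schwarz: "cmod (ell2_inner w f g) \<le> ell2_norm w f * ell2_norm w g"
proof -
  have bound: "(\<Sum>x\<in>F. norm (complex_of_real (w x) * f x * cnj (g x)))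
      \<le> ell2_norm w f * ell2_norm w g" if "finite F" for F
  proof -
    have "(\<Sum>x\<in>F. norm (complex_of_real (w x) * f x * cnj (g x)))
        = (\<Sum>x\<in>F. \<bar>sqrt (w x) * cmod (f x)\<bar> * \<bar>sqrt (w x) * cmod (g x)\<bar>)"
    proof (rule sum.cong)
      fix x
      obtain s where "s \<ge> 0" "w x = s * s"
        using w_pos[of x] that[of "sqrt (w x)"] by simp
      then show "norm (complex_of_real (w x) * f x * cnj (g x))
          = \<bar>sqrt (w x) * cmod (f x)\<bar> * \<bar>sqrt (w x) * cmod (g x)\<bar>"
        by (simp add: norm_mult abs_mult)
    qed simp
    also have "\<dots> \<le> partial_norm f F * partial_norm g F"
      by (rule L2_set_mult_ineq)
    also have "\<dots> \<le> ell2_norm w f * ell2_norm w g"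
      using that assms by (intro mult_mono partial_norm_le ell2_norm_nonneg) auto
    finally show ?thesis .
  qed
  then have *: "(\<lambda>x. norm (complex_of_real (w x) * f x * cnj (g x))) summable_on UNIV"
    by (intro nonneg_bdd_above_summable_on bdd_aboveI[where M = "ell2_norm w f * ell2_norm w g"])
       auto
  then show "(\<lambda>x. complex_of_real (w x) * f x * cnj (g x)) summable_on UNIV"
    by (rule abs_summable_summable)
  have "cmod (ell2_inner w f g) \<le> (\<Sum>\<^sub>\<infinity>x. norm (complex_of_real (w x) * f x * cnj (g x)))"
    unfolding ell2_inner_def using * by (rule norm_infsum_bound)
  also have "\<dots> \<le> ell2_norm w f * ell2_norm w g"
    using * bound by (intro infsum_le_finite_sums)
  finally show "cmod (ell2_inner w f g) \<le> ell2_norm w f * ell2_norm w g" .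
qed

lemma ell2_inner_add_left:
  assumes "f \<in> ell2 w" "g \<in> ell2 w" "h \<in> ell2 w"
  shows "ell2_inner w (\<lambda>x. f x + g x) h = ell2_inner w f h + ell2_inner w g h"
  unfolding ell2_inner_def
  using infsum_add[OF ell2_inner_summable[OF assms(1,3)] ell2_inner_summable[OF assms(2,3)]]
  by (simp add: algebra_simps)

lemma ell2_inner_scale_left: "ell2_inner w (\<lambda>x. c * f x) h = c * ell2_inner w f h"
  unfolding ell2_inner_def infsum_cmult_right'[symmetric] by (simp add: algebra_simps)

lemma ell2_inner_commute: "ell2_inner w g f = cnj (ell2_inner w f g)"
  unfolding ell2_inner_def infsum_cnj[symmetric] by (simp add: algebra_simps)

lemma ell2_inner_diff_left:
  assumes "f \<in> ell2 w" "g \<in> ell2 w" "h \<in> ell2 w"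
  shows "ell2_inner w (\<lambda>x. f x - g x) h = ell2_inner w f h - ell2_inner w g h"
  using ell2_inner_add_left[of f "\<lambda>x. (-1) * g x" h] ell2_inner_scale_left[of "-1" g h] assms
  by (simp add: ell2_scale[of g "-1", simplified])

text \<open>The values \<open>c = 1\<close> and \<open>c = -1\<close> add up to the parallelogram
  law; a general \<open>c\<close> serves to compare distances in the projection argument.\<close>

lemma ell2_norm_square_diff_scale:
  assumes "f \<in> ell2 w" "g \<in> ell2 w"
  shows "(ell2_norm w (\<lambda>x. f x - c * g x))\<^sup>2
    = (ell2_norm w f)\<^sup>2 - 2 * Re (cnj c * ell2_inner w f g) + (cmod c)\<^sup>2 * (ell2_norm w g)\<^sup>2"
proof -
  let ?h = "\<lambda>x. f x - c * g x"
  have cg: "(\<lambda>x. c * g x) \<in> ell2 w" and h: "?h \<in> ell2 w"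
    using assms by (auto intro: ell2_scale ell2_diff)
  have left: "ell2_inner w ?h k = ell2_inner w f k - c * ell2_inner w g k" if "k \<in> ell2 w" for k
    using ell2_inner_diff_left[OF assms(1) cg that] by (simp add: ell2_inner_scale_left)
  \<comment> \<open>Conjugate linearity in the second argument is linearity in the first,
    conjugated.\<close>
  have right: "ell2_inner w k ?h = ell2_inner w k f - cnj c * ell2_inner w k g" if "k \<in> ell2 w" for k
    using arg_cong[OF left[OF that], of cnj] by (simp add: ell2_inner_commute[symmetric])
  have "complex_of_real ((ell2_norm w ?h)\<^sup>2)
      = ell2_inner w f f - cnj c * ell2_inner w f g - c * ell2_inner w g f
        + c * cnj c * ell2_inner w g g"
    unfolding ell2_inner_self[symmetric] using left[OF h] right assms by (simp add: algebra_simps)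
  also have "\<dots> = ell2_inner w f f - (cnj c * ell2_inner w f g + cnj (cnj c * ell2_inner w f g))
        + c * cnj c * ell2_inner w g g"
    by (simp add: ell2_inner_commute[of g f])
  also have "\<dots> = complex_of_real ((ell2_norm w f)\<^sup>2 - 2 * Re (cnj c * ell2_inner w f g)
        + (cmod c)\<^sup>2 * (ell2_norm w g)\<^sup>2)"
    unfolding complex_add_cnj ell2_inner_self complex_norm_square[symmetric] by simp
  finally show ?thesis
    using of_real_eq_iff by blast
qed

lemma ell2_parallelogram:
  assumes "f \<in> ell2 w" "g \<in> ell2 w"
  shows "(ell2_norm w (\<lambda>x. f x + g x))\<^sup>2 + (ell2_norm w (\<lambda>x. f x - g x))\<^sup>2
    = 2 * (ell2_norm w f)\<^sup>2 + 2 * (ell2_norm w g)\<^sup>2"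
  using ell2_norm_square_diff_scale[OF assms, of 1] ell2_norm_square_diff_scale[OF assms, of "-1"]
  by simp

section \<open>Convergence, completeness and orthogonal projection\<close>

lemma ell2_tendsto_pointwise:
  assumes "\<And>n. u n \<in> ell2 w" "f \<in> ell2 w"
    and lim: "(\<lambda>n::nat. ell2_norm w (\<lambda>x. u n x - f x)) \<longlonglongrightarrow> 0"
  shows "(\<lambda>n. u n x) \<longlonglongrightarrow> f x"
proof -
  have "sqrt (w x) > 0"
    using w_pos[of x] by simp
  then have "norm (u n x - f x) \<le> ell2_norm w (\<lambda>x. u n x - f x) / sqrt (w x)" for n
    using cmod_le_ell2_norm[OF ell2_diff[OF assms(1,2)], of x]
    by (simp add: pos_le_divide_eq mult.commute)
  moreover have "(\<lambda>n. ell2_norm w (\<lambda>x. u n x - f x) / sqrt (w x)) \<longlonglongrightarrow> 0"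
    using tendsto_divide[OF lim tendsto_const, of "sqrt (w x)"] \<open>sqrt (w x) > 0\<close> by simp
  ultimately have "(\<lambda>n. u n x - f x) \<longlonglongrightarrow> 0"
    by (rule Lim_null_comparison[OF always_eventually[OF allI]])
  then show ?thesis
    by (simp add: LIM_zero_iff)
qed

lemma ell2_inner_tendsto_left:
  assumes u: "\<And>n. u n \<in> ell2 w" and "f \<in> ell2 w" "v \<in> ell2 w"
    and lim: "(\<lambda>n::nat. ell2_norm w (\<lambda>x. u n x - f x)) \<longlonglongrightarrow> 0"
  shows "(\<lambda>n. ell2_inner w (u n) v) \<longlonglongrightarrow> ell2_inner w f v"
proof -
  have "norm (ell2_inner w (u n) v - ell2_inner w f v)
      \<le> ell2_norm w (\<lambda>x. u n x - f x) * ell2_norm w v" for n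
    using ell2_Cauchy_Schwarz[OF ell2_diff[OF u assms(2)] assms(3), of n]
    by (simp add: ell2_inner_diff_left[OF u assms(2,3)])
  moreover have "(\<lambda>n. ell2_norm w (\<lambda>x. u n x - f x) * ell2_norm w v) \<longlonglongrightarrow> 0"
    using tendsto_mult[OF lim tendsto_const] by simp
  ultimately have "(\<lambda>n. ell2_inner w (u n) v - ell2_inner w f v) \<longlonglongrightarrow> 0"
    by (rule Lim_null_comparison[OF always_eventually[OF allI]])
  then show ?thesis
    by (simp add: LIM_zero_iff)
qed

text \<open>The limit is built pointwise. The Cauchy estimate survives the limit on each finite set,
  where the partial norm is continuous, and is then uniform over finite sets.\<close>

lemma ell2_complete:
  assumes u: "\<And>n::nat. u n \<in> ell2 w"
    and cauchy: "\<And>\<epsilon>. \<epsilon> > 0 \<Longrightarrow>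
      \<exists>N. \<forall>m\<ge>N. \<forall>n\<ge>N. ell2_norm w (\<lambda>x. u m x - u n x) \<le> \<epsilon>"
  obtains f where "f \<in> ell2 w" "(\<lambda>n. ell2_norm w (\<lambda>x. u n x - f x)) \<longlonglongrightarrow> 0"
proof -
  have "Cauchy (\<lambda>n. u n x)" for x
  proof (rule metric_CauchyI)
    fix \<epsilon> :: real
    assume "\<epsilon> > 0"
    have s: "sqrt (w x) > 0"
      using w_pos[of x] by simp
    \<comment> \<open>The factor \<open>sqrt (w x)\<close> cancels the loss in point evaluation; the
      half turns the weak Cauchy bound into a strict one.\<close>
    then obtain N where N: "\<forall>m\<ge>N. \<forall>n\<ge>N. ell2_norm w (\<lambda>x. u m x - u n x) \<le> sqrt (w x) * (\<epsilon> / 2)"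
      using cauchy[of "sqrt (w x) * (\<epsilon> / 2)"] \<open>\<epsilon> > 0\<close> by auto
    have "dist (u m x) (u n x) < \<epsilon>" if "m \<ge> N" "n \<ge> N" for m n
    proof -
      have "sqrt (w x) * cmod (u m x - u n x) \<le> sqrt (w x) * (\<epsilon> / 2)"
        using cmod_le_ell2_norm[OF ell2_diff[OF u u], of x m n] N that by fastforce
      then have "cmod (u m x - u n x) \<le> \<epsilon> / 2"
        using s by (simp only: mult_le_cancel_left_pos)
      then show ?thesis
        using \<open>\<epsilon> > 0\<close> by (simp add: dist_norm)
    qed
    then show "\<exists>M. \<forall>m\<ge>M. \<forall>n\<ge>M. dist (u m x) (u n x) < \<epsilon>"
      by blast
  qed
  then have "\<exists>y. (\<lambda>n. u n x) \<longlonglongrightarrow> y" for x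
    using Cauchy_convergent convergent_def by blast
  then obtain f where f: "\<And>x. (\<lambda>n. u n x) \<longlonglongrightarrow> f x"
    by metis
  \<comment> \<open>With \<open>m\<close> and \<open>F\<close> fixed, \<open>n\<close> tends to
    infinity; the threshold \<open>N\<close> does not depend on \<open>F\<close>.\<close>
  have tail: "\<exists>N. \<forall>m\<ge>N. \<forall>F. finite F \<longrightarrow> partial_norm (\<lambda>x. u m x - f x) F \<le> \<epsilon>" if "\<epsilon> > 0" for \<epsilon>
  proof -
    obtain N where N: "\<forall>m\<ge>N. \<forall>n\<ge>N. ell2_norm w (\<lambda>x. u m x - u n x) \<le> \<epsilon>"
      using cauchy \<open>\<epsilon> > 0\<close> by blast
    have "partial_norm (\<lambda>x. u m x - f x) F \<le> \<epsilon>" if "m \<ge> N" "finite F" for m F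
    proof (rule tendsto_upperbound)
      show "(\<lambda>n. partial_norm (\<lambda>x. u m x - u n x) F) \<longlonglongrightarrow> partial_norm (\<lambda>x. u m x - f x) F"
        unfolding L2_set_def by (intro tendsto_intros f)
      show "\<forall>\<^sub>F n in sequentially. partial_norm (\<lambda>x. u m x - u n x) F \<le> \<epsilon>"
        using eventually_ge_at_top[of N]
      proof eventually_elim
        case (elim n)
        then show ?case
          using partial_norm_le[OF ell2_diff[OF u u] \<open>finite F\<close>, of m n] N \<open>m \<ge> N\<close> by fastforce
      qed
    qed simp
    then show ?thesis
      by blast
  qed
  obtain M where M: "\<And>F. finite F \<Longrightarrow> partial_norm (\<lambda>x. u M x - f x) F \<le> 1"
    using tail[of 1] by auto
  \<comment> \<open>One index at finite distance suffices for membership, since \<open>f\<close> is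
    \<open>u M\<close> minus this difference.\<close>
  have "(\<lambda>x. u M x - f x) \<in> ell2 w"
    using M by (rule ell2_boundedI)
  then have fin: "f \<in> ell2 w"
    using ell2_diff[OF u[of M], of "\<lambda>x. u M x - f x"] by simp
  have "(\<lambda>n. ell2_norm w (\<lambda>x. u n x - f x)) \<longlonglongrightarrow> 0"
  proof (rule LIMSEQ_I)
    fix \<epsilon> :: real
    assume "\<epsilon> > 0"
    then obtain N where "\<forall>m\<ge>N. \<forall>F. finite F \<longrightarrow> partial_norm (\<lambda>x. u m x - f x) F \<le> \<epsilon> / 2"
      using tail[of "\<epsilon> / 2"] by auto
    then have "ell2_norm w (\<lambda>x. u m x - f x) \<le> \<epsilon> / 2" if "m \<ge> N" for m
      using that by (intro ell2_norm_le) auto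
    then have "norm (ell2_norm w (\<lambda>x. u m x - f x) - 0) < \<epsilon>" if "m \<ge> N" for m
      using that \<open>\<epsilon> > 0\<close> ell2_norm_nonneg[of "\<lambda>x. u m x - f x"] by fastforce
    then show "\<exists>N. \<forall>n\<ge>N. norm (ell2_norm w (\<lambda>x. u n x - f x) - 0) < \<epsilon>"
      by blast
  qed
  with fin that show ?thesis
    by blast
qed

text \<open>Orthogonal projection onto the closure of the subspace \<open>R\<close>: a minimizing
  sequence for the distance to \<open>h\<close> converges to some \<open>p\<close>, the residual
  \<open>h - p\<close> is orthogonal to \<open>R\<close>, and hence it vanishes. As \<open>R\<close>
  need not be closed, \<open>p\<close> is reached only as a limit of elements of
  \<open>R\<close>.\<close>

lemma ell2_dense_if_orthogonal_trivial:
  assumes R: "R \<subseteq> ell2 w" "R \<noteq> {}"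
    and add: "\<And>f g. f \<in> R \<Longrightarrow> g \<in> R \<Longrightarrow> (\<lambda>x. f x + g x) \<in> R"
    and scale: "\<And>c f. f \<in> R \<Longrightarrow> (\<lambda>x. c * f x) \<in> R"
    and trivial: "\<And>g. g \<in> ell2 w \<Longrightarrow> \<forall>r\<in>R. ell2_inner w r g = 0 \<Longrightarrow> g = (\<lambda>x. 0)"
    and h: "h \<in> ell2 w"
  shows "\<exists>r. (\<forall>n::nat. r n \<in> R) \<and> (\<lambda>n. ell2_norm w (\<lambda>x. r n x - h x)) \<longlonglongrightarrow> 0"
proof -
  define d where "d = (INF r\<in>R. ell2_norm w (\<lambda>x. h x - r x))"
  have bdd: "bdd_below ((\<lambda>r. ell2_norm w (\<lambda>x. h x - r x)) ` R)"
    using ell2_norm_nonneg by (intro bdd_belowI[where m = 0]) auto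
  have lower: "d \<le> ell2_norm w (\<lambda>x. h x - r x)" if "r \<in> R" for r
    unfolding d_def using bdd that by (rule cINF_lower)
  have d_nonneg: "d \<ge> 0"
    unfolding d_def using R(2) ell2_norm_nonneg by (intro cINF_greatest)
  have "\<exists>r\<in>R. ell2_norm w (\<lambda>x. h x - r x) < d + inverse (real (Suc n))" for n
    using cInf_lessD[of "(\<lambda>r. ell2_norm w (\<lambda>x. h x - r x)) ` R" "d + inverse (real (Suc n))"] R(2)
    by (auto simp: d_def)
  then obtain r where rR: "\<And>n. r n \<in> R"
    and r_less: "\<And>n. ell2_norm w (\<lambda>x. h x - r n x) < d + inverse (real (Suc n))"
    by metis
  have r: "r n \<in> ell2 w" for n
    using rR R(1) by blast
  \<comment> \<open>Parallelogram law for \<open>h - r m\<close> and \<open>h - r n\<close>: their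
    sum is twice the difference of \<open>h\<close> and the midpoint of \<open>r m\<close> and
    \<open>r n\<close>. The midpoint lies in \<open>R\<close>, so the sum has norm at least
    \<open>2 * d\<close>.\<close>
  have gap: "(ell2_norm w (\<lambda>x. r m x - r n x))\<^sup>2 \<le> 4 * ((d + \<delta>)\<^sup>2 - d\<^sup>2)"
    if "inverse (real (Suc m)) \<le> \<delta>" "inverse (real (Suc n)) \<le> \<delta>" for m n \<delta>
  proof -
    have mem: "(\<lambda>x. h x - r m x) \<in> ell2 w" "(\<lambda>x. h x - r n x) \<in> ell2 w"
      using h r by (auto intro: ell2_diff)
    have mid: "(\<lambda>x. (1/2) * (r m x + r n x)) \<in> R"
      by (rule scale[OF add[OF rR rR]])
    have "(\<lambda>x. (h x - r m x) + (h x - r n x)) = (\<lambda>x. 2 * (h x - (1/2) * (r m x + r n x)))"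
      by (simp add: algebra_simps)
    then have "ell2_norm w (\<lambda>x. (h x - r m x) + (h x - r n x))
        = 2 * ell2_norm w (\<lambda>x. h x - (1/2) * (r m x + r n x))"
      using ell2_norm_scale[of 2 "\<lambda>x. h x - (1/2) * (r m x + r n x)"] by (simp only:) simp
    then have "(2 * d)\<^sup>2 \<le> (ell2_norm w (\<lambda>x. (h x - r m x) + (h x - r n x)))\<^sup>2"
      using lower[OF mid] d_nonneg by (intro power_mono) auto
    moreover have "(ell2_norm w (\<lambda>x. h x - r m x))\<^sup>2 \<le> (d + \<delta>)\<^sup>2"
      "(ell2_norm w (\<lambda>x. h x - r n x))\<^sup>2 \<le> (d + \<delta>)\<^sup>2"
      using that r_less[of m] r_less[of n] by (intro power_mono ell2_norm_nonneg; linarith)+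
    moreover have "ell2_norm w (\<lambda>x. (h x - r m x) - (h x - r n x)) = ell2_norm w (\<lambda>x. r m x - r n x)"
      using ell2_norm_minus_commute[of "r n" "r m"] by (simp add: algebra_simps)
    ultimately show ?thesis
      using ell2_parallelogram[OF mem] by (simp add: power_mult_distrib)
  qed
  have "\<exists>N. \<forall>m\<ge>N. \<forall>n\<ge>N. ell2_norm w (\<lambda>x. r m x - r n x) \<le> \<epsilon>" if "\<epsilon> > 0" for \<epsilon>
  proof -
    \<comment> \<open>Solves \<open>4 * ((d + \<delta>)\<^sup>2 - d\<^sup>2) \<le>
      \<epsilon>\<^sup>2\<close>: the left side is \<open>4 * \<delta> * (2 * d + \<delta>)\<close>,
      and capping \<open>\<delta>\<close> at 1 bounds the last factor by
      \<open>2 * d + 1\<close>.\<close>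
    define \<delta> where "\<delta> = min 1 (\<epsilon>\<^sup>2 / (4 * (2 * d + 1)))"
    have \<delta>: "0 < \<delta>" "\<delta> \<le> 1" "\<delta> \<le> \<epsilon>\<^sup>2 / (4 * (2 * d + 1))"
      using that d_nonneg by (auto simp: \<delta>_def)
    obtain N where N: "inverse (real (Suc N)) < \<delta>"
      using reals_Archimedean[OF \<delta>(1)] by blast
    have "ell2_norm w (\<lambda>x. r m x - r n x) \<le> \<epsilon>" if "m \<ge> N" "n \<ge> N" for m n
    proof -
      have "inverse (real (Suc k)) \<le> \<delta>" if "k \<ge> N" for k
      proof -
        have "inverse (real (Suc k)) \<le> inverse (real (Suc N))"
          using that by (intro le_imp_inverse_le) auto
        then show ?thesis
          using N by linarith
      qed
      then have "(ell2_norm w (\<lambda>x. r m x - r n x))\<^sup>2 \<le> 4 * ((d + \<delta>)\<^sup>2 - d\<^sup>2)"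
        using that by (intro gap) auto
      also have "\<dots> = 4 * (\<delta> * (2 * d + \<delta>))"
        by (simp add: power2_eq_square algebra_simps)
      also have "\<dots> \<le> 4 * (\<delta> * (2 * d + 1))"
        using \<delta> by simp
      also have "\<dots> \<le> \<epsilon>\<^sup>2"
        using \<delta>(3) d_nonneg by (simp add: pos_le_divide_eq algebra_simps)
      finally show ?thesis
        by (rule power2_le_imp_le) (use \<open>\<epsilon> > 0\<close> in simp)
    qed
    then show ?thesis
      by blast
  qed
  then obtain p where p: "p \<in> ell2 w" and lim: "(\<lambda>n. ell2_norm w (\<lambda>x. r n x - p x)) \<longlonglongrightarrow> 0"
    by (rule ell2_complete[of r, OF r])
  define k where "k = (\<lambda>x. h x - p x)"
  have k: "k \<in> ell2 w"
    unfolding k_def using h p by (rule ell2_diff)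
  have "ell2_norm w k \<le> d"
  proof (rule tendsto_lowerbound)
    show "(\<lambda>n. d + inverse (real (Suc n)) + ell2_norm w (\<lambda>x. r n x - p x)) \<longlonglongrightarrow> d"
      using tendsto_add[OF tendsto_add[OF tendsto_const LIMSEQ_inverse_real_of_nat] lim] by simp
    have "ell2_norm w k \<le> d + inverse (real (Suc n)) + ell2_norm w (\<lambda>x. r n x - p x)" for n
      using ell2_norm_diff_triangle[OF h r p, of n] r_less[of n] by (simp add: k_def)
    then show "\<forall>\<^sub>F n in sequentially.
        ell2_norm w k \<le> d + inverse (real (Suc n)) + ell2_norm w (\<lambda>x. r n x - p x)"
      by (rule always_eventually[OF allI])
  qed simp
  \<comment> \<open>The vector \<open>p + c * s\<close> need not lie in \<open>R\<close>, but
    \<open>r n + c * s\<close> does; the lower bound for the latter passes to the limit.\<close>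
  moreover have "d \<le> ell2_norm w (\<lambda>x. k x - c * s x)" if "s \<in> R" for c s
  proof (rule tendsto_lowerbound)
    show "(\<lambda>n. ell2_norm w (\<lambda>x. k x - c * s x) + ell2_norm w (\<lambda>x. r n x - p x))
        \<longlonglongrightarrow> ell2_norm w (\<lambda>x. k x - c * s x)"
      using tendsto_add[OF tendsto_const lim] by simp
    have "d \<le> ell2_norm w (\<lambda>x. k x - c * s x) + ell2_norm w (\<lambda>x. r n x - p x)" for n
    proof -
      have "d \<le> ell2_norm w (\<lambda>x. h x - (r n x + c * s x))"
        by (intro lower add rR scale that)
      also have "(\<lambda>x. h x - (r n x + c * s x)) = (\<lambda>x. (k x - c * s x) + (p x - r n x))"
        by (simp add: k_def algebra_simps)
      also have "ell2_norm w \<dots> \<le> ell2_norm w (\<lambda>x. k x - c * s x) + ell2_norm w (\<lambda>x. p x - r n x)"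
        using k that R(1) p r by (intro ell2_norm_add ell2_diff ell2_scale) auto
      finally show ?thesis
        by (simp add: ell2_norm_minus_commute[of p])
    qed
    then show "\<forall>\<^sub>F n in sequentially.
        d \<le> ell2_norm w (\<lambda>x. k x - c * s x) + ell2_norm w (\<lambda>x. r n x - p x)"
      by (rule always_eventually[OF allI])
  qed simp
  ultimately have minimal: "ell2_norm w k \<le> ell2_norm w (\<lambda>x. k x - c * s x)" if "s \<in> R" for c s
    by (rule order_trans) (rule that)
  have "ell2_inner w s k = 0" if "s \<in> R" for s
  proof -
    have s: "s \<in> ell2 w"
      using that R(1) by blast
    define i where "i = ell2_inner w k s"
    have "i = 0"
    proof (cases "ell2_norm w s = 0")
      case True
      then show ?thesis
        using ell2_Cauchy_Schwarz[OF k s] by (simp add: i_def)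
    next
      case False
      define t where "t = (ell2_norm w s)\<^sup>2"
      have t: "t > 0"
        using False by (simp add: t_def)
      \<comment> \<open>The coefficient of the projection of \<open>k\<close> onto \<open>s\<close>.
        Subtracting \<open>?c * s\<close> lowers the squared norm by
        \<open>(cmod i)\<^sup>2 / t\<close>, which minimality allows only for
        \<open>i = 0\<close>.\<close>
      let ?c = "i / complex_of_real t"
      have "cnj ?c * i = complex_of_real ((cmod i)\<^sup>2 / t)"
        by (simp add: complex_norm_square mult.commute flip: of_real_power)
      then have re: "Re (cnj ?c * i) = (cmod i)\<^sup>2 / t"
        by (simp only: Re_complex_of_real)
      have "(cmod ?c)\<^sup>2 * t = (cmod i)\<^sup>2 / t"
        using t by (simp add: norm_divide power2_eq_square)
      then have "(ell2_norm w (\<lambda>x. k x - ?c * s x))\<^sup>2 = (ell2_norm w k)\<^sup>2 - (cmod i)\<^sup>2 / t"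
        using ell2_norm_square_diff_scale[OF k s, of ?c, folded i_def t_def] re by linarith
      moreover have "(ell2_norm w k)\<^sup>2 \<le> (ell2_norm w (\<lambda>x. k x - ?c * s x))\<^sup>2"
        by (intro power_mono minimal that ell2_norm_nonneg)
      ultimately have "(cmod i)\<^sup>2 / t \<le> 0"
        by linarith
      then show ?thesis
        using t by (simp add: divide_le_0_iff)
    qed
    then show ?thesis
      by (simp add: ell2_inner_commute[of s] i_def)
  qed
  then have "k = (\<lambda>x. 0)"
    by (intro trivial[OF k] ballI)
  then have "h = p"
    by (auto simp: k_def fun_eq_iff)
  with rR lim show ?thesis
    by (intro exI[of _ r]) simp
qed

section \<open>Delta functions and finitely supported functions\<close>

lemma ell2_inner_delta: "ell2_inner w (\<lambda>y. if y = x then 1 else 0) g = complex_of_real (w x) * cnj (g x)"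
proof -
  have "ell2_inner w (\<lambda>y. if y = x then 1 else 0) g
      = (\<Sum>\<^sub>\<infinity>y\<in>{x}. complex_of_real (w y) * cnj (g y))"
    unfolding ell2_inner_def by (rule infsum_cong_neutral) auto
  then show ?thesis
    by simp
qed

lemma delta_finitely_supported: "(\<lambda>y. if y = x then 1 else 0) \<in> finitely_supported"
  by (simp add: finitely_supported_def)

lemma finitely_supported_zero: "(\<lambda>x. 0) \<in> finitely_supported"
  by (simp add: finitely_supported_def)

lemma finitely_supported_add:
  assumes "f \<in> finitely_supported" "g \<in> finitely_supported"
  shows "(\<lambda>x. f x + g x) \<in> finitely_supported"
proof -
  have "finite ({x. f x \<noteq> 0} \<union> {x. g x \<noteq> 0})"
    using assms by (simp add: finitely_supported_def)
  then have "finite {x. f x + g x \<noteq> 0}"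
    by (rule rev_finite_subset) auto
  then show ?thesis
    by (simp add: finitely_supported_def)
qed

lemma finitely_supported_scale:
  assumes "f \<in> finitely_supported"
  shows "(\<lambda>x. c * f x) \<in> finitely_supported"
proof -
  have "finite {x. f x \<noteq> 0}"
    using assms by (simp add: finitely_supported_def)
  then have "finite {x. c * f x \<noteq> 0}"
    by (rule rev_finite_subset) auto
  then show ?thesis
    by (simp add: finitely_supported_def)
qed

text \<open>Delta functions are finitely supported, and a function orthogonal to all of them
  vanishes at every vertex.\<close>

lemma ell2_finitely_supported_dense:
  assumes "h \<in> ell2 w"
  shows "\<exists>r. (\<forall>n::nat. r n \<in> finitely_supported) \<and>
    (\<lambda>n. ell2_norm w (\<lambda>x. r n x - h x)) \<longlonglongrightarrow> 0"
proof -
  have nonempty: "(finitely_supported :: ('v \<Rightarrow> complex) set) \<noteq> {}"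
    using finitely_supported_zero by (metis empty_iff)
  have trivial: "g = (\<lambda>x. 0)"
    if "\<forall>r\<in>finitely_supported. ell2_inner w r g = 0" for g
  proof
    fix x
    show "g x = 0"
      using bspec[OF that delta_finitely_supported[of x]] w_pos[of x] by (simp add: ell2_inner_delta)
  qed
  show ?thesis
    by (rule ell2_dense_if_orthogonal_trivial[OF ell2_finitely_supported nonempty
          finitely_supported_add finitely_supported_scale trivial assms])
qed

end

section \<open>Magnetic Schroedinger operators on locally finite graphs\<close>

locale magnetic_graph = vertex_weight w
  for w :: "'v \<Rightarrow> real" +
  fixes E :: "'v set set" and a :: "'v \<times> 'v \<Rightarrow> real" and \<sigma> :: "'v \<times> 'v \<Rightarrow> complex"
  assumes locally_finite: "locally_finite E"
    and a_pos: "e \<in> oriented_edges E \<Longrightarrow> a e > 0"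
    and a_swap: "e \<in> oriented_edges E \<Longrightarrow> a (prod.swap e) = a e"
    and cmod_\<sigma>: "e \<in> oriented_edges E \<Longrightarrow> cmod (\<sigma> e) = 1"
    and \<sigma>_swap: "e \<in> oriented_edges E \<Longrightarrow> \<sigma> (prod.swap e) = cnj (\<sigma> e)"
begin

section \<open>Oriented edges, energy form and Green's formula\<close>

abbreviation H :: "('v \<Rightarrow> real) \<Rightarrow> ('v \<Rightarrow> complex) \<Rightarrow> 'v \<Rightarrow> complex" where
  "H \<equiv> magnetic_schroedinger E w a \<sigma>"

lemma swap_oriented_edges: "prod.swap e \<in> oriented_edges E \<longleftrightarrow> e \<in> oriented_edges E"
  by (cases e) (simp add: oriented_edges_def adj_def insert_commute)

lemma finite_edges_from: "finite (edges_from E x)"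
proof -
  have "edges_from E x = Pair x ` {y. adj E x y}"
    by (auto simp: edges_from_def oriented_edges_def)
  then show ?thesis
    using locally_finite by (simp add: locally_finite_def)
qed

text \<open>Both orientations of an edge are included, so the set is invariant under reversal and
  sums over it can be symmetrized.\<close>

definition edges_meeting :: "'v set \<Rightarrow> ('v \<times> 'v) set" where
  "edges_meeting S = {e \<in> oriented_edges E. fst e \<in> S \<or> snd e \<in> S}"

text \<open>Edges ending in \<open>S\<close> are reversals of edges starting in \<open>S\<close>,
  and each vertex of the finite set \<open>S\<close> emits finitely many edges.\<close>

lemma finite_edges_meeting:
  assumes "finite S"
  shows "finite (edges_meeting S)"
proof (rule finite_subset)
  show "edges_meeting S \<subseteq> (\<Union>x\<in>S. edges_from E x) \<union> prod.swap -` (\<Union>x\<in>S. edges_from E x)"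
    by (auto simp: edges_meeting_def edges_from_def oriented_edges_def adj_def insert_commute)
  show "finite ((\<Union>x\<in>S. edges_from E x) \<union> prod.swap -` (\<Union>x\<in>S. edges_from E x))"
    using assms by (auto intro!: finite_vimageI finite_edges_from)
qed

text \<open>The factor \<open>u (fst e) - \<sigma> (prod.swap e) * u (snd e)\<close> is the magnetic
  (covariant) difference of \<open>u\<close> along \<open>e\<close>.\<close>

definition edge_form :: "('v \<Rightarrow> complex) \<Rightarrow> ('v \<Rightarrow> complex) \<Rightarrow> 'v \<times> 'v \<Rightarrow> complex" where
  "edge_form u v e = complex_of_real (a e) *
     (u (fst e) - \<sigma> (prod.swap e) * u (snd e)) * cnj (v (fst e) - \<sigma> (prod.swap e) * v (snd e))"

text \<open>The form associated with the operator, for \<open>S\<close> containing the support of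
  one argument. The half compensates for each edge occurring in both orientations.\<close>

definition energy_form ::
  "('v \<Rightarrow> real) \<Rightarrow> 'v set \<Rightarrow> ('v \<Rightarrow> complex) \<Rightarrow> ('v \<Rightarrow> complex) \<Rightarrow> complex" where
  "energy_form q S u v =
     (\<Sum>e\<in>edges_meeting S. edge_form u v e) / 2 +
     (\<Sum>x\<in>S. complex_of_real (w x * q x) * u x * cnj (v x))"

lemma energy_form_commute: "energy_form q S v u = cnj (energy_form q S u v)"
  by (simp add: energy_form_def edge_form_def mult.commute mult.left_commute)

lemma \<sigma>_mult_swap:
  assumes "e \<in> oriented_edges E"
  shows "\<sigma> e * \<sigma> (prod.swap e) = 1"
  using complex_norm_square[of "\<sigma> e"] cmod_\<sigma>[OF assms] \<sigma>_swap[OF assms] by simp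

text \<open>Summing the contributions of \<open>e\<close> and of its reversal turns the operator into a form that is
  visibly symmetric, and nonnegative up to the potential.\<close>

lemma edge_form_symmetrization:
  fixes u v :: "'v \<Rightarrow> complex"
  assumes e: "e \<in> oriented_edges E"
  defines "F \<equiv> \<lambda>e. complex_of_real (a e) *
    (u (fst e) - \<sigma> (prod.swap e) * u (snd e)) * cnj (v (fst e))"
  shows "F e + F (prod.swap e) = edge_form u v e"
proof -
  define d where "d = u (fst e) - \<sigma> (prod.swap e) * u (snd e)"
  have "\<sigma> e * d = \<sigma> e * u (fst e) - (\<sigma> e * \<sigma> (prod.swap e)) * u (snd e)"
    by (simp add: d_def algebra_simps)
  then have "u (snd e) - \<sigma> e * u (fst e) = - (\<sigma> e * d)"
    by (simp add: \<sigma>_mult_swap[OF e])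
  then have "F (prod.swap e) = complex_of_real (a e) * (- (\<sigma> e * d)) * cnj (v (snd e))"
    by (simp add: F_def a_swap[OF e])
  moreover have "edge_form u v e = complex_of_real (a e) * d * (cnj (v (fst e)) - \<sigma> e * cnj (v (snd e)))"
    by (simp add: edge_form_def d_def \<sigma>_swap[OF e])
  moreover have "F e = complex_of_real (a e) * d * cnj (v (fst e))"
    by (simp add: F_def d_def)
  ultimately show ?thesis
    by (simp only:) (simp add: algebra_simps)
qed

text \<open>The edge terms are regrouped by their origins into one finite sum over
  \<open>edges_meeting S\<close>, which is then averaged with its reversal. The disjunction in the
  support condition lets the lemma apply to either side of Green's formula.\<close>

lemma ell2_inner_schroedinger:
  assumes S: "finite S" and supp: "(\<forall>x. x \<notin> S \<longrightarrow> u x = 0) \<or> (\<forall>x. x \<notin> S \<longrightarrow> v x = 0)"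
  shows "ell2_inner w (H q u) v = energy_form q S u v"
proof -
  define F where "F = (\<lambda>e. complex_of_real (a e) *
    (u (fst e) - \<sigma> (prod.swap e) * u (snd e)) * cnj (v (fst e)))"
  define G where "G = (\<lambda>x. complex_of_real (w x * q x) * u x * cnj (v x))"
  have F_swap: "F e + F (prod.swap e) = edge_form u v e" if "e \<in> oriented_edges E" for e
    using edge_form_symmetrization[OF that, of u v] by (simp add: F_def)
  let ?P = "edges_meeting S"
  \<comment> \<open>Besides \<open>S\<close>, the origins of edges pointing into \<open>S\<close>
    are needed: \<open>H q u\<close> can be nonzero there when \<open>u\<close> is supported in
    \<open>S\<close>.\<close>
  define T where "T = S \<union> fst ` ?P"
  have P: "finite ?P"
    using S by (rule finite_edges_meeting)
  then have T: "finite T"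
    using S by (simp add: T_def)
  have F0: "F e = 0" if "e \<in> oriented_edges E" "e \<notin> ?P" for e
  proof -
    have "fst e \<notin> S" "snd e \<notin> S"
      using that by (auto simp: edges_meeting_def)
    then show ?thesis
      using supp by (auto simp: F_def)
  qed
  have local: "complex_of_real (w x) * H q u x * cnj (v x) = (\<Sum>e\<in>edges_from E x. F e) + G x" for x
  proof -
    have "(\<Sum>e\<in>edges_from E x. F e)
        = (\<Sum>e\<in>edges_from E x. complex_of_real (a e) * (u x - \<sigma> (prod.swap e) * u (snd e))) * cnj (v x)"
      unfolding sum_distrib_right by (rule sum.cong) (auto simp: F_def edges_from_def)
    then show ?thesis
      using w_pos[of x]
      by (simp add: magnetic_schroedinger_def magnetic_laplacian_def G_def distrib_left distrib_right)
  qed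
  have "(\<Sum>e\<in>edges_from E x. F e) + G x = 0" if "x \<notin> T" for x
  proof -
    have "F e = 0" if "e \<in> edges_from E x" for e
      using that \<open>x \<notin> T\<close> by (intro F0) (auto simp: T_def edges_from_def)
    moreover have "G x = 0"
      using supp \<open>x \<notin> T\<close> by (auto simp: G_def T_def)
    ultimately show ?thesis
      by simp
  qed
  then have "ell2_inner w (H q u) v = (\<Sum>\<^sub>\<infinity>x\<in>T. (\<Sum>e\<in>edges_from E x. F e) + G x)"
    unfolding ell2_inner_def local by (intro infsum_cong_neutral) auto
  also have "\<dots> = (\<Sum>x\<in>T. \<Sum>e\<in>edges_from E x. F e) + (\<Sum>x\<in>T. G x)"
    using T by (simp add: sum.distrib)
  also have "(\<Sum>x\<in>T. G x) = (\<Sum>x\<in>S. G x)"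
    using T supp by (intro sum.mono_neutral_right) (auto simp: T_def G_def)
  also have "(\<Sum>x\<in>T. \<Sum>e\<in>edges_from E x. F e) = (\<Sum>x\<in>T. \<Sum>e\<in>{e \<in> ?P. fst e = x}. F e)"
  proof (rule sum.cong[OF refl])
    fix x
    show "(\<Sum>e\<in>edges_from E x. F e) = (\<Sum>e\<in>{e \<in> ?P. fst e = x}. F e)"
      using finite_edges_from F0
      by (intro sum.mono_neutral_right) (auto simp: edges_from_def edges_meeting_def)
  qed
  also have "\<dots> = (\<Sum>e\<in>?P. F e)"
    using P T by (intro sum.group) (auto simp: T_def)
  also have "(\<Sum>e\<in>?P. F e) = (\<Sum>e\<in>?P. edge_form u v e) / 2"
  proof -
    \<comment> \<open>Reversal is an involution of \<open>?P\<close>, so doubling the sum pairs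
      every edge with its reversal.\<close>
    have "(\<Sum>e\<in>?P. F e) = (\<Sum>e\<in>?P. F (prod.swap e))"
      by (rule sum.reindex_bij_witness[of _ prod.swap prod.swap])
         (auto simp: edges_meeting_def oriented_edges_def adj_def insert_commute)
    then have "2 * (\<Sum>e\<in>?P. F e) = (\<Sum>e\<in>?P. F e + F (prod.swap e))"
      by (simp add: sum.distrib)
    also have "\<dots> = (\<Sum>e\<in>?P. edge_form u v e)"
      by (rule sum.cong) (auto simp: edges_meeting_def intro!: F_swap)
    finally show ?thesis
      by (simp add: mult.commute[of _ 2])
  qed
  finally show ?thesis
    by (simp add: energy_form_def G_def)
qed

text \<open>Both sides are the energy form over the support of \<open>u\<close>, which is Hermitian.
  Here \<open>v\<close> is an arbitrary function, so that the formula can identify adjoints.\<close>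

lemma Green_formula:
  assumes "u \<in> finitely_supported"
  shows "ell2_inner w (H q u) v = ell2_inner w u (H q v)"
proof -
  have S: "finite {x. u x \<noteq> 0}"
    using assms by (simp add: finitely_supported_def)
  have "ell2_inner w (H q u) v = cnj (energy_form q {x. u x \<noteq> 0} v u)"
    using ell2_inner_schroedinger[OF S, of u v q] by (simp add: energy_form_commute[of q _ u v])
  also have "energy_form q {x. u x \<noteq> 0} v u = ell2_inner w (H q v) u"
    using ell2_inner_schroedinger[OF S, of v u q] by simp
  finally show ?thesis
    by (simp add: ell2_inner_commute[of u])
qed

section \<open>Locality and linearity of the operator\<close>

lemma schroedinger_finitely_supported:
  assumes "u \<in> finitely_supported"
  shows "H q u \<in> finitely_supported"
proof -
  let ?S = "{x. u x \<noteq> 0}"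
  let ?T = "?S \<union> fst ` edges_meeting ?S"
  have "finite ?T"
    using assms finite_edges_meeting by (simp add: finitely_supported_def)
  moreover have "H q u x = 0" if "x \<notin> ?T" for x
  proof -
    have "u x = 0"
      using that by simp
    moreover have "u (snd e) = 0" if "e \<in> edges_from E x" for e
      using that \<open>x \<notin> ?T\<close> by (force simp: edges_from_def edges_meeting_def)
    ultimately show ?thesis
      by (simp add: magnetic_schroedinger_def magnetic_laplacian_def)
  qed
  then have "{x. H q u x \<noteq> 0} \<subseteq> ?T"
    by blast
  ultimately show ?thesis
    by (simp add: finitely_supported_def finite_subset)
qed

lemma schroedinger_add: "H q (\<lambda>x. f x + g x) = (\<lambda>x. H q f x + H q g x)"
  by (simp add: magnetic_schroedinger_def magnetic_laplacian_def algebra_simps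
      sum.distrib sum_subtractf fun_eq_iff)

lemma schroedinger_scale: "H q (\<lambda>x. c * f x) = (\<lambda>x. c * H q f x)"
  by (simp add: magnetic_schroedinger_def magnetic_laplacian_def algebra_simps
      sum_distrib_left sum_subtractf fun_eq_iff)

lemma schroedinger_diff: "H q (\<lambda>x. f x - g x) = (\<lambda>x. H q f x - H q g x)"
  using schroedinger_add[of q f "\<lambda>x. (-1) * g x"] schroedinger_scale[of q "-1" g] by simp

lemma schroedinger_shift: "H (\<lambda>x. q x + c) u x = H q u x + complex_of_real c * u x"
  by (simp add: magnetic_schroedinger_def algebra_simps)

text \<open>The value at \<open>x\<close> involves finitely many values of the function. This
  continuity makes the operator closed on its maximal domain.\<close>

lemma schroedinger_tendsto:
  assumes "\<And>y. (\<lambda>n. u n y) \<longlonglongrightarrow> f y"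
  shows "(\<lambda>n. H q (u n) x) \<longlonglongrightarrow> H q f x"
  unfolding magnetic_schroedinger_def magnetic_laplacian_def by (intro tendsto_intros assms)

text \<open>Green's formula moves the operator onto \<open>v\<close>; testing with delta functions
  then compares \<open>z\<close> and \<open>H q v\<close> vertex by vertex.\<close>

lemma adjoint_eq_schroedinger:
  assumes "\<And>u. u \<in> finitely_supported \<Longrightarrow> ell2_inner w (H q u) v = ell2_inner w u z"
  shows "z = H q v"
proof
  fix x
  show "z x = H q v x"
    using assms[OF delta_finitely_supported[of x]] Green_formula[OF delta_finitely_supported[of x], of q v]
      w_pos[of x] by (simp add: ell2_inner_delta)
qed

section \<open>Coercivity and injectivity for positive potentials\<close>

lemma schroedinger_coercive:
  assumes q: "\<And>x. q x \<ge> 1" and u: "u \<in> finitely_supported"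
  shows "ell2_norm w u \<le> ell2_norm w (H q u)"
proof -
  let ?S = "{x. u x \<noteq> 0}"
  have S: "finite ?S"
    using u by (simp add: finitely_supported_def)
  have mem: "u \<in> ell2 w" "H q u \<in> ell2 w"
    using u schroedinger_finitely_supported ell2_finitely_supported by blast+
  \<comment> \<open>On the diagonal the edge form is a squared modulus times \<open>a e\<close>.
    Dropping it leaves the potential term, which dominates the squared norm because
    \<open>q x \<ge> 1\<close>; Cauchy-Schwarz then gives the bound.\<close>
  have "Re (edge_form u u e) \<ge> 0" if "e \<in> oriented_edges E" for e
  proof -
    have "edge_form u u e
        = complex_of_real (a e * (cmod (u (fst e) - \<sigma> (prod.swap e) * u (snd e)))\<^sup>2)"
      unfolding edge_form_def of_real_mult complex_norm_square by (simp only: mult.assoc)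
    then show ?thesis
      using a_pos[OF that] by simp
  qed
  then have edges: "(\<Sum>e\<in>edges_meeting ?S. Re (edge_form u u e)) \<ge> 0"
    by (intro sum_nonneg) (simp add: edges_meeting_def)
  have "(ell2_norm w u)\<^sup>2 = (\<Sum>\<^sub>\<infinity>x. w x * (cmod (u x))\<^sup>2)"
    by (simp add: ell2_norm_eq infsum_norm_square_nonneg)
  also have "\<dots> = (\<Sum>\<^sub>\<infinity>x\<in>?S. w x * (cmod (u x))\<^sup>2)"
    by (rule infsum_cong_neutral) auto
  also have "\<dots> = (\<Sum>x\<in>?S. w x * (cmod (u x))\<^sup>2)"
    using S by simp
  also have "\<dots> \<le> (\<Sum>x\<in>?S. w x * q x * (cmod (u x))\<^sup>2)"
  proof (rule sum_mono)
    fix x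
    show "w x * (cmod (u x))\<^sup>2 \<le> w x * q x * (cmod (u x))\<^sup>2"
      using q[of x] w_pos[of x] by (intro mult_right_mono) simp_all
  qed
  also have "\<dots> = Re (\<Sum>x\<in>?S. complex_of_real (w x * q x) * u x * cnj (u x))"
  proof -
    have "complex_of_real (w x * q x) * u x * cnj (u x)
        = complex_of_real (w x * q x * (cmod (u x))\<^sup>2)" for x
      by (simp only: of_real_mult complex_norm_square mult.assoc)
    then show ?thesis
      by (simp only: Re_sum Re_complex_of_real)
  qed
  also have "\<dots> \<le> Re (ell2_inner w (H q u) u)"
    unfolding ell2_inner_schroedinger[OF S, of u u q, simplified] energy_form_def
    using edges by simp
  also have "\<dots> \<le> cmod (ell2_inner w (H q u) u)"
    by (rule complex_Re_le_cmod)
  also have "\<dots> \<le> ell2_norm w (H q u) * ell2_norm w u"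
    using mem by (intro ell2_Cauchy_Schwarz)
  finally have "ell2_norm w u * ell2_norm w u \<le> ell2_norm w (H q u) * ell2_norm w u"
    by (simp add: power2_eq_square)
  then show ?thesis
    using ell2_norm_nonneg[of u] ell2_norm_nonneg[of "H q u"]
    by (cases "ell2_norm w u = 0") simp_all
qed

text \<open>The lower bound on the weight forces the modulus of \<open>u\<close> to attain its
  maximum at some \<open>y\<close>. Multiplying the equation at \<open>y\<close> by
  \<open>cnj (u y)\<close> and taking real parts leaves nonnegative edge terms and a strictly
  positive potential term with sum 0.\<close>

lemma schroedinger_kernel_trivial:
  assumes w\<^sub>0: "w\<^sub>0 > 0" "\<And>x. w\<^sub>0 \<le> w x"
    and q: "\<And>x. q x > 0" and u: "u \<in> ell2 w" and zero: "H q u = (\<lambda>x. 0)"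
  shows "u = (\<lambda>x. 0)"
proof (rule ccontr)
  assume "u \<noteq> (\<lambda>x. 0)"
  then obtain x\<^sub>0 where x\<^sub>0: "u x\<^sub>0 \<noteq> 0"
    by auto
  \<comment> \<open>Each vertex of \<open>K\<close> contributes at least
    \<open>w\<^sub>0 * (cmod (u x\<^sub>0))\<^sup>2\<close> to the squared norm, so \<open>K\<close>
    is finite. A maximum over \<open>K\<close> is global, since outside \<open>K\<close> the modulus
    is below \<open>cmod (u x\<^sub>0)\<close>.\<close>
  define K where "K = {x. cmod (u x\<^sub>0) \<le> cmod (u x)}"
  have "finite K"
  proof (rule ccontr)
    assume "infinite K"
    let ?c = "w\<^sub>0 * (cmod (u x\<^sub>0))\<^sup>2"
    have c: "?c > 0"
      using w\<^sub>0 x\<^sub>0 by simp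
    obtain n :: nat where n: "(ell2_norm w u)\<^sup>2 < real n * ?c"
      using reals_Archimedean3[OF c] by blast
    obtain F where F: "finite F" "card F = n" "F \<subseteq> K"
      using infinite_arbitrarily_large[OF \<open>infinite K\<close>] by blast
    have "real n * ?c = (\<Sum>x\<in>F. ?c)"
      using F by simp
    also have "\<dots> \<le> (\<Sum>x\<in>F. w x * (cmod (u x))\<^sup>2)"
      using F w\<^sub>0 by (intro sum_mono mult_mono power_mono) (auto simp: K_def intro: less_imp_le[OF w_pos])
    also have "\<dots> \<le> (ell2_norm w u)\<^sup>2"
      unfolding partial_norm_square[symmetric] using partial_norm_le[OF u F(1)]
      by (intro power_mono) auto
    finally show False
      using n by simp
  qed
  moreover have "x\<^sub>0 \<in> K"
    by (simp add: K_def)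
  ultimately have "Max ((\<lambda>x. cmod (u x)) ` K) \<in> (\<lambda>x. cmod (u x)) ` K"
    by (intro Max_in) auto
  then obtain y where y: "y \<in> K" "cmod (u y) = Max ((\<lambda>x. cmod (u x)) ` K)"
    by auto
  have y_max: "cmod (u x) \<le> cmod (u y)" for x
  proof (cases "x \<in> K")
    case True
    then show ?thesis
      using \<open>finite K\<close> y(2) by (simp add: Max_ge)
  next
    case False
    then show ?thesis
      using y(1) by (simp add: K_def)
  qed
  have pos: "cmod (u y) > 0"
    using y(1) x\<^sub>0 by (auto simp: K_def intro: less_le_trans[of 0 "cmod (u x\<^sub>0)"])
  let ?t = "\<lambda>e. complex_of_real (a e) * (u y - \<sigma> (prod.swap e) * u (snd e)) * cnj (u y)"
  have "Re (?t e) \<ge> 0" if "e \<in> edges_from E y" for e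
  proof -
    have e: "e \<in> oriented_edges E"
      using that by (simp add: edges_from_def)
    \<comment> \<open>The phase has modulus 1, so the product is at most
      \<open>(cmod (u y))\<^sup>2\<close> by maximality at \<open>y\<close>.\<close>
    have "Re (\<sigma> (prod.swap e) * u (snd e) * cnj (u y)) \<le> cmod (\<sigma> (prod.swap e) * u (snd e) * cnj (u y))"
      by (rule complex_Re_le_cmod)
    also have "\<dots> = cmod (u (snd e)) * cmod (u y)"
      using e by (simp add: norm_mult cmod_\<sigma> swap_oriented_edges)
    also have "\<dots> \<le> cmod (u y) * cmod (u y)"
      using y_max by (intro mult_right_mono) auto
    also have "\<dots> = Re (u y * cnj (u y))"
      by (simp add: cmod_power2 power2_eq_square[symmetric])
    finally have "Re ((u y - \<sigma> (prod.swap e) * u (snd e)) * cnj (u y)) \<ge> 0"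
      by (simp add: left_diff_distrib)
    then show ?thesis
      using a_pos[OF e] by (simp add: mult.assoc)
  qed
  then have "Re (\<Sum>e\<in>edges_from E y. ?t e) \<ge> 0"
    by (auto simp: Re_sum intro: sum_nonneg)
  moreover have "(\<Sum>e\<in>edges_from E y. ?t e) + complex_of_real (w y * q y * (cmod (u y))\<^sup>2)
      = complex_of_real (w y) * H q u y * cnj (u y)"
  proof -
    have "complex_of_real (w y * q y * (cmod (u y))\<^sup>2)
        = complex_of_real (w y) * (complex_of_real (q y) * u y) * cnj (u y)"
      by (simp only: of_real_mult complex_norm_square mult.assoc)
    moreover have "(\<Sum>e\<in>edges_from E y. ?t e)
        = complex_of_real (w y) * magnetic_laplacian E w a \<sigma> u y * cnj (u y)"
      using w_pos[of y] by (simp add: magnetic_laplacian_def sum_distrib_right)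
    ultimately show ?thesis
      by (simp add: magnetic_schroedinger_def distrib_left distrib_right)
  qed
  ultimately have "w y * q y * (cmod (u y))\<^sup>2 \<le> 0"
    using zero by (simp add: complex_eq_iff)
  moreover have "w y * q y * (cmod (u y))\<^sup>2 > 0"
    using pos w_pos q by simp
  ultimately show False
    by simp
qed

section \<open>Approximation by finitely supported functions in the graph norm\<close>

lemma schroedinger_core_positive:
  assumes w\<^sub>0: "w\<^sub>0 > 0" "\<And>x. w\<^sub>0 \<le> w x"
    and q: "\<And>x. q x \<ge> 1" and v: "v \<in> ell2 w" "H q v \<in> ell2 w"
  obtains u :: "nat \<Rightarrow> 'v \<Rightarrow> complex"
  where "\<And>n. u n \<in> finitely_supported"
    and "(\<lambda>n. ell2_norm w (\<lambda>x. u n x - v x)) \<longlonglongrightarrow> 0"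
    and "(\<lambda>n. ell2_norm w (\<lambda>x. H q (u n) x - H q v x)) \<longlonglongrightarrow> 0"
proof -
  have q_pos: "q x > 0" for x
    using q[of x] by simp
  note kernel = schroedinger_kernel_trivial[of _ q, OF w\<^sub>0 q_pos]
  have fs: "f \<in> ell2 w" "H q f \<in> ell2 w" if "f \<in> finitely_supported" for f
    using that schroedinger_finitely_supported ell2_finitely_supported by blast+
  have range: "H q ` finitely_supported \<subseteq> ell2 w" "H q ` finitely_supported \<noteq> {}"
    using fs finitely_supported_zero by auto
  have add: "(\<lambda>x. f x + g x) \<in> H q ` finitely_supported"
    if "f \<in> H q ` finitely_supported" "g \<in> H q ` finitely_supported" for f g
    using that finitely_supported_add schroedinger_add[symmetric] by blast
  have scale: "(\<lambda>x. c * f x) \<in> H q ` finitely_supported"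
    if "f \<in> H q ` finitely_supported" for c f
    using that finitely_supported_scale schroedinger_scale[symmetric] by blast
  \<comment> \<open>Orthogonality to the range says that the pair of \<open>g\<close> and 0 belongs
    to the adjoint, so \<open>H q g = 0\<close> and injectivity applies. Hence the range is
    dense.\<close>
  have trivial: "g = (\<lambda>x. 0)"
    if g: "g \<in> ell2 w" and orth: "\<forall>r\<in>H q ` finitely_supported. ell2_inner w r g = 0" for g
  proof -
    have "(\<lambda>x. 0) = H q g"
      by (rule adjoint_eq_schroedinger) (simp add: orth ell2_inner_def[of _ _ "\<lambda>x. 0"])
    then show ?thesis
      using kernel[OF g] by simp
  qed
  have "\<exists>r. (\<forall>n::nat. r n \<in> H q ` finitely_supported) \<and>
      (\<lambda>n. ell2_norm w (\<lambda>x. r n x - H q v x)) \<longlonglongrightarrow> 0"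
    by (rule ell2_dense_if_orthogonal_trivial[OF range add scale trivial v(2)])
  then obtain r where r: "\<And>n::nat. r n \<in> H q ` finitely_supported"
    and lim: "(\<lambda>n. ell2_norm w (\<lambda>x. r n x - H q v x)) \<longlonglongrightarrow> 0"
    by blast
  have "\<forall>n. \<exists>u. u \<in> finitely_supported \<and> r n = H q u"
    using r by blast
  then obtain u where u: "\<And>n. u n \<in> finitely_supported" and Hu: "\<And>n. r n = H q (u n)"
    by metis
  \<comment> \<open>Coercivity, applied to the finitely supported differences, pulls the Cauchy
    property of the images back to the preimages.\<close>
  have "\<exists>N. \<forall>m\<ge>N. \<forall>n\<ge>N. ell2_norm w (\<lambda>x. u m x - u n x) \<le> \<epsilon>" if "\<epsilon> > 0" for \<epsilon>
  proof -
    have "\<epsilon> / 2 > 0"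
      using that by simp
    from order_tendstoD(2)[OF lim this]
    obtain N where N: "\<And>n. n \<ge> N \<Longrightarrow> ell2_norm w (\<lambda>x. r n x - H q v x) < \<epsilon> / 2"
      unfolding eventually_sequentially by blast
    have "ell2_norm w (\<lambda>x. u m x - u n x) \<le> \<epsilon>" if "m \<ge> N" "n \<ge> N" for m n
    proof -
      have "(\<lambda>x. u m x - u n x) \<in> finitely_supported"
        using finitely_supported_add[OF u[of m] finitely_supported_scale[OF u[of n], of "-1"]]
        by simp
      then have "ell2_norm w (\<lambda>x. u m x - u n x) \<le> ell2_norm w (\<lambda>x. r m x - r n x)"
        using schroedinger_coercive[of q, OF q] by (simp add: Hu schroedinger_diff[symmetric])
      also have "\<dots> \<le> ell2_norm w (\<lambda>x. r m x - H q v x) + ell2_norm w (\<lambda>x. H q v x - r n x)"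
        using r range v by (intro ell2_norm_diff_triangle) auto
      also have "\<dots> \<le> \<epsilon>"
        using N[OF that(1)] N[OF that(2)] ell2_norm_minus_commute[of "r n" "H q v"] by linarith
      finally show ?thesis .
    qed
    then show ?thesis
      by blast
  qed
  then obtain f where f: "f \<in> ell2 w" and u_lim: "(\<lambda>n. ell2_norm w (\<lambda>x. u n x - f x)) \<longlonglongrightarrow> 0"
    by (rule ell2_complete[of u, OF fs(1)[OF u]])
  have "H q f = H q v"
  proof
    fix x
    have "(\<lambda>n. H q (u n) x) \<longlonglongrightarrow> H q f x"
      by (rule schroedinger_tendsto, rule ell2_tendsto_pointwise[OF fs(1)[OF u] f u_lim])
    moreover have "(\<lambda>n. H q (u n) x) \<longlonglongrightarrow> H q v x"
      by (rule ell2_tendsto_pointwise[OF fs(2)[OF u] v(2)]) (use lim in \<open>simp add: Hu\<close>)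
    ultimately show "H q f x = H q v x"
      by (rule LIMSEQ_unique)
  qed
  \<comment> \<open>The preimages converge to \<open>f\<close>, which is not yet known to be
    \<open>v\<close>; injectivity on all of \<open>ell2 w\<close> identifies the two.\<close>
  then have "H q (\<lambda>x. f x - v x) = (\<lambda>x. 0)"
    by (simp add: schroedinger_diff)
  then have "(\<lambda>x. f x - v x) = (\<lambda>x. 0)"
    by (rule kernel[OF ell2_diff[OF f v(1)]])
  then have "f = v"
    by (auto simp: fun_eq_iff)
  with u u_lim lim show ?thesis
    by (intro that) (auto simp: Hu)
qed

text \<open>Adding the constant \<open>C + 1\<close> makes the potential at least 1. It changes the
  operator by a bounded multiple of the identity, so graph-norm convergence is unaffected.\<close>

lemma schroedinger_core:
  assumes w\<^sub>0: "w\<^sub>0 > 0" "\<And>x. w\<^sub>0 \<le> w x"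
    and q: "\<And>x. q x \<ge> - C" and v: "v \<in> ell2 w" "H q v \<in> ell2 w"
  obtains u :: "nat \<Rightarrow> 'v \<Rightarrow> complex"
  where "\<And>n. u n \<in> finitely_supported"
    and "(\<lambda>n. ell2_norm w (\<lambda>x. u n x - v x)) \<longlonglongrightarrow> 0"
    and "(\<lambda>n. ell2_norm w (\<lambda>x. H q (u n) x - H q v x)) \<longlonglongrightarrow> 0"
proof -
  let ?p = "\<lambda>x. q x + (C + 1)" and ?c = "complex_of_real (C + 1)"
  have p: "?p x \<ge> 1" for x
    using q[of x] by simp
  have Hp: "H ?p v \<in> ell2 w"
    unfolding schroedinger_shift using v by (intro ell2_add ell2_scale)
  obtain u where u: "\<And>n::nat. u n \<in> finitely_supported"
    and lim: "(\<lambda>n. ell2_norm w (\<lambda>x. u n x - v x)) \<longlonglongrightarrow> 0"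
    and Hlim: "(\<lambda>n. ell2_norm w (\<lambda>x. H ?p (u n) x - H ?p v x)) \<longlonglongrightarrow> 0"
    by (rule schroedinger_core_positive[of w\<^sub>0 ?p v, OF w\<^sub>0 p v(1) Hp]) (rule that; simp)
  have fs: "f \<in> ell2 w" "H p f \<in> ell2 w" if "f \<in> finitely_supported" for f p
    using that schroedinger_finitely_supported ell2_finitely_supported by blast+
  have "ell2_norm w (\<lambda>x. H q (u n) x - H q v x)
      \<le> ell2_norm w (\<lambda>x. H ?p (u n) x - H ?p v x) + cmod ?c * ell2_norm w (\<lambda>x. u n x - v x)" for n
  proof -
    have "(\<lambda>x. H q (u n) x - H q v x)
        = (\<lambda>x. (H ?p (u n) x - H ?p v x) + (- ?c) * (u n x - v x))"
      unfolding schroedinger_shift by (simp add: algebra_simps)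
    then have "ell2_norm w (\<lambda>x. H q (u n) x - H q v x)
        \<le> ell2_norm w (\<lambda>x. H ?p (u n) x - H ?p v x) + ell2_norm w (\<lambda>x. (- ?c) * (u n x - v x))"
      using fs[OF u] v(1) Hp by (simp only:) (intro ell2_norm_add ell2_scale ell2_diff)
    then show ?thesis
      by (simp only: ell2_norm_scale norm_minus_cancel)
  qed
  then have bound: "norm (ell2_norm w (\<lambda>x. H q (u n) x - H q v x))
      \<le> ell2_norm w (\<lambda>x. H ?p (u n) x - H ?p v x) + cmod ?c * ell2_norm w (\<lambda>x. u n x - v x)" for n
    by (simp only: real_norm_def abs_of_nonneg[OF ell2_norm_nonneg])
  have "(\<lambda>n. ell2_norm w (\<lambda>x. H ?p (u n) x - H ?p v x) + cmod ?c * ell2_norm w (\<lambda>x. u n x - v x))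
      \<longlonglongrightarrow> 0"
    using tendsto_add[OF Hlim tendsto_mult[OF tendsto_const lim]] by simp
  with bound have "(\<lambda>n. ell2_norm w (\<lambda>x. H q (u n) x - H q v x)) \<longlonglongrightarrow> 0"
    by (rule Lim_null_comparison[OF always_eventually[OF allI]])
  with u lim show ?thesis
    by (rule that)
qed

section \<open>The maximal operator as closure and as its own adjoint\<close>

definition maximal_operator :: "('v \<Rightarrow> real) \<Rightarrow> 'v operator_graph" where
  "maximal_operator q = {(v, H q v) | v. v \<in> ell2 w \<and> H q v \<in> ell2 w}"

lemma minimal_subset_maximal: "restricted_to (H q) finitely_supported \<subseteq> maximal_operator q"
  using schroedinger_finitely_supported ell2_finitely_supported
  by (fastforce simp: restricted_to_def maximal_operator_def)

lemma linear_operator_maximal: "linear_operator_in w (maximal_operator q)"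
proof -
  have "single_valued (maximal_operator q)"
    by (auto simp: single_valued_def maximal_operator_def)
  moreover have "H q (\<lambda>x. 0) = (\<lambda>x. 0)"
    using schroedinger_scale[of q 0 "\<lambda>x. 0"] by simp
  ultimately show ?thesis
    by (auto simp: linear_operator_in_def maximal_operator_def schroedinger_add schroedinger_scale
        ell2_zero ell2_add ell2_scale)
qed

text \<open>Stated for extensions so as to serve both the operator on finitely supported functions
  and the maximal one.\<close>

lemma densely_defined_if_extends_minimal:
  assumes "restricted_to (H q) finitely_supported \<subseteq> A"
  shows "densely_defined w A"
  unfolding densely_defined_def
proof (intro ballI allI impI)
  fix f :: "'v \<Rightarrow> complex" and \<epsilon> :: real
  assume "f \<in> ell2 w" "\<epsilon> > 0"
  obtain r where r: "\<And>n::nat. r n \<in> finitely_supported"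
    and lim: "(\<lambda>n. ell2_norm w (\<lambda>x. r n x - f x)) \<longlonglongrightarrow> 0"
    using ell2_finitely_supported_dense[OF \<open>f \<in> ell2 w\<close>] by blast
  obtain n where "ell2_norm w (\<lambda>x. r n x - f x) < \<epsilon>"
    using LIMSEQ_D[OF lim \<open>\<epsilon> > 0\<close>] ell2_norm_nonneg by auto
  then have "ell2_norm w (\<lambda>x. f x - r n x) < \<epsilon>"
    by (simp add: ell2_norm_minus_commute[of f])
  moreover have "(r n, H q (r n)) \<in> A"
    using assms r by (auto simp: restricted_to_def)
  ultimately show "\<exists>g\<in>Domain A. ell2_norm w (\<lambda>x. f x - g x) < \<epsilon>"
    by blast
qed

lemma closure_minimal_sequence:
  assumes "(f, g) \<in> closure_graph w (restricted_to (H q) finitely_supported)"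
  shows "f \<in> ell2 w" "g \<in> ell2 w"
    and "\<exists>u. (\<forall>n::nat. u n \<in> finitely_supported) \<and>
      (\<lambda>n. ell2_norm w (\<lambda>x. u n x - f x)) \<longlonglongrightarrow> 0 \<and>
      (\<lambda>n. ell2_norm w (\<lambda>x. H q (u n) x - g x)) \<longlonglongrightarrow> 0"
  using assms by (auto simp: closure_graph_def restricted_to_def)

text \<open>A graph limit lies in the maximal operator because norm limits are pointwise limits and
  \<open>H q\<close> respects these. The converse inclusion is the approximation in
  \<open>schroedinger_core\<close>.\<close>

lemma closure_minimal:
  assumes w\<^sub>0: "w\<^sub>0 > 0" "\<And>x. w\<^sub>0 \<le> w x" and q: "\<And>x. q x \<ge> - C"
  shows "closure_graph w (restricted_to (H q) finitely_supported) = maximal_operator q"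
proof (intro equalityI subrelI)
  fix f g
  assume "(f, g) \<in> closure_graph w (restricted_to (H q) finitely_supported)"
  then obtain u where f: "f \<in> ell2 w" and g: "g \<in> ell2 w"
    and u: "\<And>n. u n \<in> finitely_supported"
    and lim: "(\<lambda>n. ell2_norm w (\<lambda>x. u n x - f x)) \<longlonglongrightarrow> 0"
    and Hlim: "(\<lambda>n::nat. ell2_norm w (\<lambda>x. H q (u n) x - g x)) \<longlonglongrightarrow> 0"
    using closure_minimal_sequence by blast
  have fs: "u n \<in> ell2 w" "H q (u n) \<in> ell2 w" for n
    using u schroedinger_finitely_supported ell2_finitely_supported by blast+
  have "g = H q f"
  proof
    fix x
    have "(\<lambda>n. H q (u n) x) \<longlonglongrightarrow> H q f x"
      by (rule schroedinger_tendsto, rule ell2_tendsto_pointwise[OF fs(1) f lim])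
    with ell2_tendsto_pointwise[OF fs(2) g Hlim] show "g x = H q f x"
      by (rule LIMSEQ_unique)
  qed
  with f g show "(f, g) \<in> maximal_operator q"
    by (simp add: maximal_operator_def)
next
  fix f g
  assume "(f, g) \<in> maximal_operator q"
  then have f: "f \<in> ell2 w" and g: "g = H q f" "H q f \<in> ell2 w"
    by (auto simp: maximal_operator_def)
  obtain u where "\<And>n::nat. u n \<in> finitely_supported"
    "(\<lambda>n. ell2_norm w (\<lambda>x. u n x - f x)) \<longlonglongrightarrow> 0"
    "(\<lambda>n. ell2_norm w (\<lambda>x. H q (u n) x - H q f x)) \<longlonglongrightarrow> 0"
    by (rule schroedinger_core[of w\<^sub>0 C q f, OF w\<^sub>0 q f g(2)]) (rule that; simp)
  then show "(f, g) \<in> closure_graph w (restricted_to (H q) finitely_supported)"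
    unfolding closure_graph_def restricted_to_def using f g
    by (simp, intro exI[of _ u] exI[of _ "\<lambda>n. H q (u n)"]) simp
qed

text \<open>An adjoint pair is tested on finitely supported functions only, which already forces
  \<open>z = H q v\<close>. For the converse, Green's formula must reach all of the maximal domain,
  which works by approximating the first argument.\<close>

lemma adjoint_maximal:
  assumes closure: "closure_graph w (restricted_to (H q) finitely_supported) = maximal_operator q"
  shows "adjoint_graph w (maximal_operator q) = maximal_operator q"
proof (intro equalityI subrelI)
  fix v z
  assume vz: "(v, z) \<in> adjoint_graph w (maximal_operator q)"
  have "ell2_inner w (H q u) v = ell2_inner w u z" if "u \<in> finitely_supported" for u
  proof -
    have "(u, H q u) \<in> maximal_operator q"
      using minimal_subset_maximal[of q] that by (auto simp: restricted_to_def)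
    then show ?thesis
      using vz by (auto simp: adjoint_graph_def)
  qed
  then have "z = H q v"
    by (rule adjoint_eq_schroedinger)
  then show "(v, z) \<in> maximal_operator q"
    using vz by (auto simp: adjoint_graph_def maximal_operator_def)
next
  fix v z
  assume "(v, z) \<in> maximal_operator q"
  then have v: "v \<in> ell2 w" and z: "z = H q v" "H q v \<in> ell2 w"
    by (auto simp: maximal_operator_def)
  have "ell2_inner w g v = ell2_inner w f z" if "(f, g) \<in> maximal_operator q" for f g
  proof -
    have "(f, g) \<in> closure_graph w (restricted_to (H q) finitely_supported)"
      using that closure by simp
    then obtain u where f: "f \<in> ell2 w" and g: "g \<in> ell2 w"
      and u: "\<And>n. u n \<in> finitely_supported"
      and lim: "(\<lambda>n. ell2_norm w (\<lambda>x. u n x - f x)) \<longlonglongrightarrow> 0"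
      and Hlim: "(\<lambda>n::nat. ell2_norm w (\<lambda>x. H q (u n) x - g x)) \<longlonglongrightarrow> 0"
      using closure_minimal_sequence by blast
    have fs: "u n \<in> ell2 w" "H q (u n) \<in> ell2 w" for n
      using u schroedinger_finitely_supported ell2_finitely_supported by blast+
    \<comment> \<open>By Green's formula the same sequence is
      \<open>ell2_inner w (H q (u n)) v\<close>, so it has two limits, which must agree.\<close>
    have "(\<lambda>n. ell2_inner w (u n) (H q v)) \<longlonglongrightarrow> ell2_inner w g v"
      using ell2_inner_tendsto_left[OF fs(2) g v Hlim] by (simp add: Green_formula[OF u])
    moreover have "(\<lambda>n. ell2_inner w (u n) (H q v)) \<longlonglongrightarrow> ell2_inner w f (H q v)"
      by (rule ell2_inner_tendsto_left[OF fs(1) f z(2) lim])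
    ultimately show ?thesis
      unfolding z(1) by (rule LIMSEQ_unique)
  qed
  then show "(v, z) \<in> adjoint_graph w (maximal_operator q)"
    using v z by (auto simp: adjoint_graph_def)
qed

lemma linear_operator_minimal: "linear_operator_in w (restricted_to (H q) finitely_supported)"
proof -
  have "single_valued (restricted_to (H q) finitely_supported)"
    by (auto simp: single_valued_def restricted_to_def)
  moreover have "H q (\<lambda>x. 0) = (\<lambda>x. 0)"
    using schroedinger_scale[of q 0 "\<lambda>x. 0"] by simp
  moreover have "restricted_to (H q) finitely_supported \<subseteq> ell2 w \<times> ell2 w"
    using schroedinger_finitely_supported ell2_finitely_supported by (auto simp: restricted_to_def)
  ultimately show ?thesis
    by (auto simp: linear_operator_in_def restricted_to_def schroedinger_add schroedinger_scale
        finitely_supported_zero finitely_supported_add finitely_supported_scale)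
qed

text \<open>Symmetry is Green's formula, and self-adjointness of the closure is that of the maximal
  operator, with which the closure coincides.\<close>

lemma essentially_self_adjoint_schroedinger:
  assumes "w\<^sub>0 > 0" "\<And>x. w\<^sub>0 \<le> w x" and "\<And>x. q x \<ge> - C"
  shows "essentially_self_adjoint w (restricted_to (H q) finitely_supported)"
proof -
  note closure = closure_minimal[of w\<^sub>0 C q, OF assms]
  have "symmetric_operator w (restricted_to (H q) finitely_supported)"
    unfolding symmetric_operator_def
    using linear_operator_minimal densely_defined_if_extends_minimal[OF order_refl]
    by (auto simp: restricted_to_def Green_formula)
  moreover have "self_adjoint w (maximal_operator q)"
    unfolding self_adjoint_def
    using linear_operator_maximal densely_defined_if_extends_minimal[OF minimal_subset_maximal]
      adjoint_maximal[OF closure] by blast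
  ultimately show ?thesis
    by (simp add: essentially_self_adjoint_def closure)
qed

end

theorem theorem1p3:
  fixes E :: "'v set set"
    and Es :: "('v \<times> 'v) set"
    and w :: "'v \<Rightarrow> real"
    and a :: "'v \<times> 'v \<Rightarrow> real"
    and \<sigma> :: "'v \<times> 'v \<Rightarrow> complex"
    and q :: "'v \<Rightarrow> real"
    and w\<^sub>0 C :: real
  assumes "simple_graph E"
    and "infinite (UNIV :: 'v set)"
    and "locally_finite E"
    and "connected_graph E"
    and "is_orientation E Es"
    and "w\<^sub>0 > 0"
    and "\<And>x. w x = w\<^sub>0"
    and "\<And>e. e \<in> oriented_edges E \<Longrightarrow> a e > 0"
    and "\<And>e. e \<in> oriented_edges E \<Longrightarrow> a e = a (prod.swap e)"
    and "\<And>e. e \<in> oriented_edges E \<Longrightarrow> cmod (\<sigma> e) = 1"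
    and "\<And>e. e \<in> oriented_edges E \<Longrightarrow> \<sigma> (prod.swap e) = cnj (\<sigma> e)"
    and "\<And>x. q x \<ge> - C"
  shows "essentially_self_adjoint w
           (restricted_to (magnetic_schroedinger E w a \<sigma> q) finitely_supported)"
proof -
  interpret magnetic_graph w E a \<sigma>
    using assms(3,6-11) by unfold_locales (simp_all del: split_paired_All)
  show ?thesis
    \<comment> \<open>The constant weight is bounded below by its own value
      \<open>w\<^sub>0\<close>.\<close>
    using assms(6,7,12) by (intro essentially_self_adjoint_schroedinger[of w\<^sub>0 C]) simp_all
qed

end
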